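(* Let $(x_n,y_n)$, $n\ge1$, be the canonical positive integer solutions along the terminal branch, with $x_1=3$ and $y_1=2$, and define $d_n:=\kappa(n+1)-\kappa(n)\in\{1,2\}$. For every $n\geq2$, there is a unique $\beta_n\in\{0,1,2,3,4,5\}$ such that $$x_n=\frac{2x_{n-1}-1+\beta_n2^{\kappa(n)+2}}{3},\qquad y_n=\frac{y_{n-1}+\beta_n3^n}{2^{d_n-1}},$$ where $1\leq x_n<2^{\sigma_n}$.
   Context: Let $\kappa(n)=\lfloor n\log_2 3\rfloor$ for $n\ge1$ and $\sigma_n=\lfloor 1+(n+1)\log_2 3\rfloor=\kappa(n+1)+1$. For $n\ge1$ the terminal vector of level $n$ is $w_n=(1,\ldots,1,0,\ldots,0)$ with $n+1$ ones followed by $\kappa(n)-n$ zeros. Its canonical positive integer solution $(x_n,y_n)$ is the unique pair of positive integers with $1\le x_n<2^{\sigma_n}$ satisfying $$2^{\sigma_n}y_n=3^{n+1}(x_n+1)-2^{n+1}.$$ Equivalently, for $T(x)=x/2$ ($x$ even), $T(x)=(3x+1)/2$ ($x$ odd), $x_n$ is the unique integer in $\{1,\ldots,2^{\sigma_n}-1\}$ such that, among $T^0(x_n),\ldots,T^{\sigma_n-1}(x_n)$, exactly the first $n+1$ terms are odd, and $y_n=T^{\sigma_n}(x_n)$. For $n=1$ this gives $(x_1,y_1)=(3,2)$. *)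

theory Defs
  imports Complex_Main "HOL-Number_Theory.Cong"
begin

definition kappa :: "nat \<Rightarrow> nat"
  where "kappa n = nat \<lfloor>real n * log 2 3\<rfloor>"

definition sigma :: "nat \<Rightarrow> nat"
  where "sigma n = nat \<lfloor>1 + real (n + 1) * log 2 3\<rfloor>"

definition kappa_step :: "nat \<Rightarrow> nat"
  where "kappa_step n = kappa (n + 1) - kappa n"

definition is_canonical_solution :: "nat \<Rightarrow> int \<Rightarrow> int \<Rightarrow> bool"
  where "is_canonical_solution n x y \<longleftrightarrow>
    1 \<le> x \<and> x < 2 ^ sigma n \<and> 0 < y \<and>
    2 ^ sigma n * y = 3 ^ (n + 1) * (x + 1) - 2 ^ (n + 1)"

definition canonical_x :: "nat \<Rightarrow> int"
  where "canonical_x n = (THE x. \<exists>y. is_canonical_solution n x y)"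

definition canonical_y :: "nat \<Rightarrow> int"
  where "canonical_y n = (THE y. \<exists>x. is_canonical_solution n x y)"

text \<open>
  The equation determines \<open>x\<close> modulo \<open>2 ^ sigma n\<close>, so the pair exists and is unique and
  the descriptions above are proper.
\<close>

lemma sigma_eq: "sigma n = kappa (n + 1) + 1"
proof -
  have "0 \<le> real (n + 1) * log 2 3" by simp
  then have "0 \<le> \<lfloor>real (n + 1) * log 2 3\<rfloor>" by simp
  moreover have "\<lfloor>1 + real (n + 1) * log 2 3\<rfloor> = 1 + \<lfloor>real (n + 1) * log 2 3\<rfloor>" by linarith
  ultimately show ?thesis
    unfolding sigma_def kappa_def by (simp only: nat_add_distrib)
qed

lemma le_kappa: "n \<le> kappa n"
proof -
  have "1 \<le> log 2 (3::real)" by (simp add: le_log_iff)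
  then have "real n * 1 \<le> real n * log 2 3" by (intro mult_left_mono) auto
  then show ?thesis unfolding kappa_def by (simp add: le_nat_iff le_floor_iff)
qed

lemma canonical_solution_unique:
  assumes "is_canonical_solution n x y" "is_canonical_solution n x' y'"
  shows "x = x'" "y = y'"
proof -
  have eq: "2 ^ sigma n * (y - y') = 3 ^ (n + 1) * (x - x')"
    using assms unfolding is_canonical_solution_def by (simp add: algebra_simps)
  have "coprime ((2::int) ^ sigma n) (3 ^ (n + 1))" by (intro coprime_power_left_iff[THEN iffD2] coprime_power_right_iff[THEN iffD2] disjI1) simp
  moreover have "2 ^ sigma n dvd 3 ^ (n + 1) * (x - x')"
    by (metis eq dvd_triv_left)
  ultimately have dvd: "2 ^ sigma n dvd x - x'"
    using coprime_dvd_mult_right_iff by blast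
  have "\<bar>x - x'\<bar> < 2 ^ sigma n"
    using assms unfolding is_canonical_solution_def by auto
  with dvd show x: "x = x'"
    using dvd_imp_le_int[of "x - x'" "2 ^ sigma n"] by fastforce
  show "y = y'" using eq x by simp
qed

lemma canonical_solution_ex: "\<exists>x y. is_canonical_solution n x y"
proof -
  define m :: int where "m = 2 ^ sigma n"
  define a :: int where "a = 3 ^ (n + 1)"
  have s: "n + 1 \<le> sigma n" "0 < sigma n" using le_kappa[of "n + 1"] by (auto simp: sigma_eq)
  have m: "0 < m" "even m" using s by (auto simp: m_def)
  have "coprime a m" unfolding a_def m_def
    by (intro coprime_power_left_iff[THEN iffD2] coprime_power_right_iff[THEN iffD2] disjI1) simp
  then obtain b where b: "[a * b = 1] (mod m)" using cong_solve_coprime_int by blast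
  define x where "x = (b * 2 ^ (n + 1) - 1) mod m"
  have xr: "0 \<le> x" "x < m" using m by (auto simp: x_def)
  have "[x = b * 2 ^ (n + 1) - 1] (mod m)" by (simp add: x_def)
  then have cx: "[x + 1 = b * 2 ^ (n + 1)] (mod m)"
    using cong_add[OF _ cong_refl[of 1]] by fastforce
  have "[a * (x + 1) = a * (b * 2 ^ (n + 1))] (mod m)" using cx by (rule cong_scalar_left)
  also have "[a * (b * 2 ^ (n + 1)) = 1 * 2 ^ (n + 1)] (mod m)"
    using cong_scalar_right[OF b] by (simp add: mult.assoc)
  finally have "m dvd a * (x + 1) - 2 ^ (n + 1)" by (simp add: cong_iff_dvd_diff)
  then obtain y where y: "a * (x + 1) - 2 ^ (n + 1) = m * y" by blast
  have "2 ^ (n + 1) dvd m" unfolding m_def using s by (intro le_imp_power_dvd)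
  then have "2 ^ (n + 1) dvd x + 1"
    using cx by (metis cong_dvd_iff cong_dvd_modulus dvd_triv_right)
  moreover have "0 < x + 1" using xr by simp
  ultimately have x1: "2 ^ (n + 1) \<le> x + 1" by (rule zdvd_imp_le)
  have "(2::int) \<le> 2 ^ (n + 1)" by simp
  with x1 have "1 \<le> x" by linarith
  have "1 < a" unfolding a_def by (rule one_less_power) auto
  then have "x + 1 < a * (x + 1)" using \<open>1 \<le> x\<close> by simp
  with x1 y have "0 < m * y" by linarith
  then have "0 < y" using m by (simp add: zero_less_mult_iff)
  have "is_canonical_solution n x y"
    unfolding is_canonical_solution_def
    using \<open>1 \<le> x\<close> xr \<open>0 < y\<close> y by (simp add: m_def a_def)
  then show ?thesis by blast
qed

lemma is_canonical_solution_canonical: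
  "is_canonical_solution n (canonical_x n) (canonical_y n)"
proof -
  obtain x y where xy: "is_canonical_solution n x y" using canonical_solution_ex by blast
  have "canonical_x n = x" "canonical_y n = y"
    unfolding canonical_x_def canonical_y_def
    by (rule the_equality; use xy canonical_solution_unique in blast)+
  with xy show ?thesis by simp
qed

end

theory Submission
  imports Defs
begin

text \<open>
  Doubling the equation of level \<open>n - 1\<close> gives it the same term \<open>2 ^ (n + 1)\<close> as the equation of
  level \<open>n\<close>, so that subtraction removes this term. With \<open>d = kappa_step n\<close> what remains is
    \<open>2 ^ (kappa n + 2) * (2 ^ (d - 1) * y\<^sub>n - y\<^sub>n\<^sub>-\<^sub>1) = 3 ^ n * (3 * x\<^sub>n - 2 * x\<^sub>n\<^sub>-\<^sub>1 + 1)\<close>.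
  The powers of \<open>2\<close> and \<open>3\<close> are coprime, so a single integer \<open>\<beta>\<close> is the quotient of
  \<open>3 * x\<^sub>n - 2 * x\<^sub>n\<^sub>-\<^sub>1 + 1\<close> by \<open>2 ^ (kappa n + 2)\<close> and of \<open>2 ^ (d - 1) * y\<^sub>n - y\<^sub>n\<^sub>-\<^sub>1\<close> by \<open>3 ^ n\<close>.
  These are the two recursions; the first of them determines \<open>\<beta>\<close>. The range of \<open>\<beta>\<close> is a matter of
  size: \<open>2 * x\<^sub>n\<^sub>-\<^sub>1 < 2 ^ (kappa n + 2)\<close> excludes \<open>\<beta> \<le> -1\<close>, and \<open>d \<le> 2\<close> gives
  \<open>3 * x\<^sub>n < 3 * 2 ^ (kappa n + 3) = 6 * 2 ^ (kappa n + 2)\<close>, which excludes \<open>\<beta> \<ge> 6\<close>.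
\<close>

lemma kappa_eqI:
  assumes "2 ^ k \<le> (3::nat) ^ n" "3 ^ n < (2::nat) ^ (k + 1)"
  shows "kappa n = k"
proof -
  have log: "real n * log 2 3 = log 2 (3 ^ n)"
    by (simp add: log_nat_power)
  have "real (2 ^ k) \<le> real (3 ^ n)" "real (3 ^ n) < real (2 ^ (k + 1))"
    using assms by (simp_all only: of_nat_le_iff of_nat_less_iff)
  then have "2 powr real k \<le> 3 ^ n" "3 ^ n < 2 powr (real k + 1)"
    by (simp_all add: powr_realpow powr_add mult.commute)
  then have "real k \<le> real n * log 2 3" "real n * log 2 3 < real k + 1"
    unfolding log by (simp_all add: le_log_iff log_less_iff)
  then have "\<lfloor>real n * log 2 3\<rfloor> = int k"
    by (intro floor_unique) simp_all
  then show ?thesis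
    by (simp add: kappa_def)
qed

lemma kappa_Suc_bounds: "kappa n + 1 \<le> kappa (n + 1)" "kappa (n + 1) \<le> kappa n + 2"
proof -
  have log: "1 \<le> log 2 (3::real)" "log 2 (3::real) < 2"
    by (simp_all add: le_log_iff log_less_iff)
  have split: "real (n + 1) * log 2 3 = real n * log 2 3 + log 2 3"
    by (simp add: algebra_simps)
  have nonneg: "0 \<le> real n * log 2 3"
    by simp
  have "\<lfloor>real n * log 2 3\<rfloor> + 1 \<le> \<lfloor>real (n + 1) * log 2 3\<rfloor>"
    "\<lfloor>real (n + 1) * log 2 3\<rfloor> \<le> \<lfloor>real n * log 2 3\<rfloor> + 2"
    unfolding split using log by linarith+
  moreover have "0 \<le> \<lfloor>real n * log 2 3\<rfloor>"
    using nonneg by simp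
  ultimately show "kappa n + 1 \<le> kappa (n + 1)" "kappa (n + 1) \<le> kappa n + 2"
    unfolding kappa_def by linarith+
qed

lemma kappa_step_cases: "kappa_step n \<in> {1, 2}"
  using kappa_Suc_bounds[of n] by (auto simp: kappa_step_def)

lemma sigma_eq_kappa_step: "sigma n = kappa n + 2 + (kappa_step n - 1)"
  using kappa_Suc_bounds[of n] by (simp add: sigma_eq kappa_step_def)

lemma canonical_1: "canonical_x 1 = 3" "canonical_y 1 = 2"
proof -
  have "kappa 2 = 3"
    by (rule kappa_eqI) simp_all
  then have "sigma 1 = 4"
    using sigma_eq[of 1] by (simp only: one_add_one)
  then have "is_canonical_solution 1 3 2"
    by (simp add: is_canonical_solution_def)
  then show "canonical_x 1 = 3" "canonical_y 1 = 2"
    using canonical_solution_unique is_canonical_solution_canonical by blast+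
qed

text \<open>
  By coprimality the cofactor \<open>v\<close> absorbs \<open>a\<close>; cancelling \<open>a\<close> leaves the same quotient on
  the other side. This is why one \<open>\<beta>\<close> serves \<open>x\<close> and \<open>y\<close> simultaneously.
\<close>

lemma coprime_cross_mult_common_quotient:
  fixes a b u v :: int
  assumes "coprime a b" "a \<noteq> 0" "a * u = b * v"
  obtains c where "u = c * b" "v = c * a"
proof -
  have "a dvd b * v"
    by (metis assms(3) dvd_triv_left)
  then have "a dvd v"
    using assms(1) coprime_dvd_mult_right_iff by blast
  then obtain c where c: "v = a * c"
    by blast
  with assms have "u = c * b"
    by simp
  moreover from c have "v = c * a"
    by simp
  ultimately show ?thesis
    by (rule that)
qed

lemma canonical_solution_recursion:
  assumes prev: "is_canonical_solution m x' y'" and cur: "is_canonical_solution (Suc m) x y"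
  obtains \<beta> where "\<beta> \<in> {0, 1, 2, 3, 4, 5}"
    "3 * x = 2 * x' - 1 + \<beta> * 2 ^ (kappa (Suc m) + 2)"
    "2 ^ (kappa_step (Suc m) - 1) * y = y' + \<beta> * 3 ^ Suc m"
proof -
  define M :: int where "M = 2 ^ (kappa (Suc m) + 2)"
  define D :: int where "D = 2 ^ (kappa_step (Suc m) - 1)"
  define A :: int where "A = 3 ^ Suc m"
  have M: "0 < M"
    by (simp add: M_def)
  have D: "D \<le> 2"
    using kappa_step_cases[of "Suc m"] by (auto simp: D_def)
  have prev_pow: "M = 2 * 2 ^ sigma m"
    by (simp add: M_def sigma_eq)
  have cur_pow: "M * D = 2 ^ sigma (Suc m)"
    by (simp add: M_def D_def sigma_eq_kappa_step power_add)
  have eq': "M * y' = 2 * A * (x' + 1) - 4 * 2 ^ m"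
    using prev by (simp add: is_canonical_solution_def prev_pow A_def algebra_simps)
  have eq: "M * D * y = 3 * A * (x + 1) - 4 * 2 ^ m"
    using cur by (simp add: is_canonical_solution_def cur_pow A_def)
  have "M * (D * y - y') = A * (3 * x - 2 * x' + 1)"
    using eq eq' by (simp add: algebra_simps)
  moreover have "coprime M A"
    unfolding M_def A_def by (simp add: coprime_power_left_iff coprime_power_right_iff
        del: power_Suc power_add_numeral2)
  moreover have "M \<noteq> 0"
    using M by simp
  ultimately obtain \<beta> where \<beta>: "D * y - y' = \<beta> * A" "3 * x - 2 * x' + 1 = \<beta> * M"
    by (elim coprime_cross_mult_common_quotient)
  have x': "1 \<le> x'" "2 * x' < M" and x: "1 \<le> x" "x < M * D"
    using prev cur unfolding cur_pow by (simp_all add: is_canonical_solution_def prev_pow)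
  have "M * D \<le> M * 2"
    using D M by (intro mult_left_mono) simp_all
  then have "(-1) * M < \<beta> * M" "\<beta> * M < 6 * M"
    using x x' \<beta>(2) by linarith+
  then have "-1 < \<beta>" "\<beta> < 6"
    using M mult_less_cancel_right_pos by blast+
  then have "\<beta> \<in> {0, 1, 2, 3, 4, 5}"
    by auto
  moreover have "3 * x = 2 * x' - 1 + \<beta> * M" "D * y = y' + \<beta> * A"
    using \<beta> by linarith+
  ultimately show thesis
    using that unfolding M_def D_def A_def by blast
qed

theorem proposition22:
  shows "canonical_x 1 = 3 \<and> canonical_y 1 = 2 \<and>
    (\<forall>n\<ge>1. kappa_step n \<in> {1, 2}) \<and>
    (\<forall>n\<ge>2.
      1 \<le> canonical_x n \<and> canonical_x n < 2 ^ sigma n \<and>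
      (\<exists>!\<beta>::int. \<beta> \<in> {0, 1, 2, 3, 4, 5} \<and>
        real_of_int (canonical_x n) =
          (2 * real_of_int (canonical_x (n - 1)) - 1 + real_of_int \<beta> * 2 ^ (kappa n + 2)) / 3 \<and>
        real_of_int (canonical_y n) =
          (real_of_int (canonical_y (n - 1)) + real_of_int \<beta> * 3 ^ n) / 2 ^ (kappa_step n - 1)))"
proof (intro conjI allI impI)
  fix n :: nat
  assume "2 \<le> n"
  show "1 \<le> canonical_x n" "canonical_x n < 2 ^ sigma n"
    using is_canonical_solution_canonical[of n] by (simp_all add: is_canonical_solution_def)
  have n: "Suc (n - 1) = n"
    using \<open>2 \<le> n\<close> by simp
  obtain \<beta> where \<beta>: "\<beta> \<in> {0, 1, 2, 3, 4, 5}"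
    and x: "3 * canonical_x n = 2 * canonical_x (n - 1) - 1 + \<beta> * 2 ^ (kappa n + 2)"
    and y: "2 ^ (kappa_step n - 1) * canonical_y n = canonical_y (n - 1) + \<beta> * 3 ^ n"
    using canonical_solution_recursion[OF is_canonical_solution_canonical
        is_canonical_solution_canonical, of "n - 1"] unfolding n by metis
  have x_real: "real_of_int (canonical_x n) =
      (2 * real_of_int (canonical_x (n - 1)) - 1 + real_of_int \<beta> * 2 ^ (kappa n + 2)) / 3"
    using arg_cong[OF x, of real_of_int] by simp
  have y_real: "real_of_int (canonical_y n) =
      (real_of_int (canonical_y (n - 1)) + real_of_int \<beta> * 3 ^ n) / 2 ^ (kappa_step n - 1)"
    using arg_cong[OF y, of real_of_int] by (simp add: field_simps)
  show "\<exists>!\<beta>::int. \<beta> \<in> {0, 1, 2, 3, 4, 5} \<and>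
      real_of_int (canonical_x n) =
        (2 * real_of_int (canonical_x (n - 1)) - 1 + real_of_int \<beta> * 2 ^ (kappa n + 2)) / 3 \<and>
      real_of_int (canonical_y n) =
        (real_of_int (canonical_y (n - 1)) + real_of_int \<beta> * 3 ^ n) / 2 ^ (kappa_step n - 1)"
  proof (rule ex1I[of _ \<beta>])
    fix \<gamma> :: int
    assume "\<gamma> \<in> {0, 1, 2, 3, 4, 5} \<and>
      real_of_int (canonical_x n) =
        (2 * real_of_int (canonical_x (n - 1)) - 1 + real_of_int \<gamma> * 2 ^ (kappa n + 2)) / 3 \<and>
      real_of_int (canonical_y n) =
        (real_of_int (canonical_y (n - 1)) + real_of_int \<gamma> * 3 ^ n) / 2 ^ (kappa_step n - 1)"
    then have "real_of_int \<gamma> * 2 ^ (kappa n + 2) = real_of_int \<beta> * 2 ^ (kappa n + 2)"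
      using x_real by argo
    then show "\<gamma> = \<beta>"
      by simp
  qed (use \<beta> x_real y_real in blast)
qed (use canonical_1 kappa_step_cases in blast)+

end
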